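(* Let $X\subseteq\mathbb C$ be a set with a marked point $a\in X$ (with the usual metric). Suppose that $X$ is strongly tangent equivalent at the point $a$ to a starlike set with the center $a$. Then all pretangent spaces to $X$ at the point $a$ lie in tangent spaces, and there is a closed cone $B\subseteq\mathbb C$ with a vertex $b$ such that for every tangent space $\Omega_{a,\tilde r}^X$ to $X$ at $a$ there exists an isometry $\psi:\Omega^X_{a,\tilde r}\to B$ with $\psi(\alpha)=b$, where $\alpha=p(\tilde a)$.
   Context: Pretangent and tangent spaces. Let $(X,d)$ be a metric space with a marked point $a\in X$. A normalizing sequence is a sequence $\tilde r=\{r_n\}_{n\in\mathbb N}$ of positive reals with $r_n\to0$. $\tilde X$ is the set of all sequences of points of $X$. Sequences $\tilde x=\{x_n\},\tilde y=\{y_n\}\in\tilde X$ are mutually stable w.r.t. $\tilde r$ if the finite limit $\tilde d_{\tilde r}(\tilde x,\tilde y)=\tilde d(\tilde x,\tilde y):=\lim_{n\to\infty} d(x_n,y_n)/r_n$ exists. A family $\tilde F\subseteq\tilde X$ is self-stable (w.r.t. $\tilde r$) if every two of its elements are mutually stable; it is maximal self-stable if it is self-stable and every $\tilde z\in\tilde X$ either belongs to $\tilde F$ or is not mutually stable with some $\tilde x\in\tilde F$. Write $\tilde a=(a,a,\dots)$. $\tilde X_{a,\tilde r}$ denotes a maximal self-stable (w.r.t. $\tilde r$) family containing $\tilde a$; $\tilde d$ is a pseudometric on it. The metric identification of $(\tilde X_{a,\tilde r},\tilde d)$ (the quotient by $\tilde d(\tilde x,\tilde y)=0$ with the induced metric)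 is denoted $\Omega_{a,\tilde r}=\Omega^X_{a,\tilde r}$ and called a pretangent space to $X$ at $a$ w.r.t. $\tilde r$ (it depends on the choice of $\tilde X_{a,\tilde r}$); $p:\tilde X_{a,\tilde r}\to\Omega_{a,\tilde r}$ is the quotient map. An isometry is a distance-preserving surjection. For a subsequence $\tilde r'=\{r_{n_k}\}_k$ of $\tilde r$ ($n_k$ strictly increasing) and $\tilde x\in\tilde X$ put $\tilde x'=\{x_{n_k}\}_k$. There is a maximal self-stable (w.r.t. $\tilde r'$) family $\tilde X_{a,\tilde r'}\supseteq\{\tilde x':\tilde x\in\tilde X_{a,\tilde r}\}$, and $\tilde x\mapsto\tilde x'$ induces a distance-preserving map $em':\Omega_{a,\tilde r}\to\Omega_{a,\tilde r'}$, where $\Omega_{a,\tilde r'}$ is the metric identification of $\tilde X_{a,\tilde r'}$. The pretangent space $\Omega_{a,\tilde r}$ is tangent if $em'$ is an isometry for every subsequence $\tilde r'$ (this does not depend on the choice of $\tilde X_{a,\tilde r'}$). The pretangent space $\Omega_{a,\tilde r}$ (with corresponding family $\tilde X_{a,\tilde r}$) lies in a tangent space $\Omega_{a,\tilde r'}$ if for some subsequence $\tilde r'$ of $\tilde r$ there is a maximal self-stable (w.r.t. $\tilde r'$) family $\tilde X_{a,\tilde r'}\supseteq\{\tilde x':\tilde x\in\tilde X_{a,\tilde r}\}$ whose metric identification $\Omega_{a,\tilde r'}$ is tangent. Strong tangent equivalence. Let $Y,Z$ be subspaces of a metric space $(W,d)$ with $a\in Y\cap Z$ (here $W=\mathbb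 C$). $Y$ and $Z$ are tangent equivalent at $a$ w.r.t. $\tilde r$ if for all sequences $\{y_n^{(1)}\}$ in $Y$ and $\{z_n^{(1)}\}$ in $Z$ for which the limits $\lim d(y_n^{(1)},a)/r_n$ and $\lim d(z_n^{(1)},a)/r_n$ exist and are finite, there are sequences $\{y_n^{(2)}\}$ in $Y$ and $\{z_n^{(2)}\}$ in $Z$ with $\lim d(y_n^{(1)},z_n^{(2)})/r_n=\lim d(y_n^{(2)},z_n^{(1)})/r_n=0$. They are strongly tangent equivalent at $a$ if they are tangent equivalent at $a$ w.r.t. every normalizing sequence $\tilde r$. Cones and starlike sets. A set $A\subseteq\mathbb C$ is starlike with center $a$ if $[a,b]=\{a+t(b-a):t\in[0,1]\}\subseteq A$ for all $b\in A$. $A$ is a cone with vertex $a$ if the ray $l_a(b)=\{a+t(b-a):t\in[0,\infty)\}$ lies in $A$ for every $b\in A$. *)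

theory Defs
  imports "HOL-Analysis.Analysis"
begin

section \<open>Pretangent and tangent spaces\<close>

definition normalizing :: "(nat \<Rightarrow> real) \<Rightarrow> bool" where
  "normalizing r \<longleftrightarrow> (\<forall>n. 0 < r n) \<and> r \<longlonglongrightarrow> 0"

definition point_seqs :: "'a set \<Rightarrow> (nat \<Rightarrow> 'a) set" where
  "point_seqs X = {x. \<forall>n. x n \<in> X}"

definition mutually_stable ::
    "(nat \<Rightarrow> real) \<Rightarrow> (nat \<Rightarrow> 'a::metric_space) \<Rightarrow> (nat \<Rightarrow> 'a) \<Rightarrow> bool" where
  "mutually_stable r x y \<longleftrightarrow> convergent (\<lambda>n. dist (x n) (y n) / r n)"

definition dtilde ::
    "(nat \<Rightarrow> real) \<Rightarrow> (nat \<Rightarrow> 'a::metric_space) \<Rightarrow> (nat \<Rightarrow> 'a) \<Rightarrow> real" where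
  "dtilde r x y = lim (\<lambda>n. dist (x n) (y n) / r n)"

definition self_stable :: "(nat \<Rightarrow> real) \<Rightarrow> (nat \<Rightarrow> 'a::metric_space) set \<Rightarrow> bool" where
  "self_stable r F \<longleftrightarrow> (\<forall>x\<in>F. \<forall>y\<in>F. mutually_stable r x y)"

definition maximal_self_stable ::
    "'a::metric_space set \<Rightarrow> (nat \<Rightarrow> real) \<Rightarrow> (nat \<Rightarrow> 'a) set \<Rightarrow> bool" where
  "maximal_self_stable X r F \<longleftrightarrow>
     F \<subseteq> point_seqs X \<and> self_stable r F \<and>
     (\<forall>z\<in>point_seqs X. z \<in> F \<or> (\<exists>x\<in>F. \<not> mutually_stable r x z))"

text \<open>A pretangent space is determined by the maximal self-stable family it is the metric
  identification of, so statements about pretangent spaces quantify over such families.\<close>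

definition pretangent_family ::
    "'a::metric_space set \<Rightarrow> 'a \<Rightarrow> (nat \<Rightarrow> real) \<Rightarrow> (nat \<Rightarrow> 'a) set \<Rightarrow> bool" where
  "pretangent_family X a r F \<longleftrightarrow> maximal_self_stable X r F \<and> (\<lambda>n. a) \<in> F"

definition ident_rel ::
    "(nat \<Rightarrow> real) \<Rightarrow> (nat \<Rightarrow> 'a::metric_space) set \<Rightarrow> ((nat \<Rightarrow> 'a) \<times> (nat \<Rightarrow> 'a)) set" where
  "ident_rel r F = {(x, y). x \<in> F \<and> y \<in> F \<and> dtilde r x y = 0}"

definition pt_space ::
    "(nat \<Rightarrow> real) \<Rightarrow> (nat \<Rightarrow> 'a::metric_space) set \<Rightarrow> (nat \<Rightarrow> 'a) set set" where
  "pt_space r F = F // ident_rel r F"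

definition pt_proj ::
    "(nat \<Rightarrow> real) \<Rightarrow> (nat \<Rightarrow> 'a::metric_space) set \<Rightarrow> (nat \<Rightarrow> 'a) \<Rightarrow> (nat \<Rightarrow> 'a) set" where
  "pt_proj r F x = ident_rel r F `` {x}"

text \<open>The common value of \<open>dtilde r\<close> on representatives of the two classes;
  see \<open>pt_dist_pt_proj\<close> below.\<close>

definition pt_dist ::
    "(nat \<Rightarrow> real) \<Rightarrow> (nat \<Rightarrow> 'a::metric_space) set \<Rightarrow> (nat \<Rightarrow> 'a) set \<Rightarrow> real" where
  "pt_dist r A B = the_elem ((\<lambda>(x, y). dtilde r x y) ` (A \<times> B))"

definition isometry_between ::
    "'a set \<Rightarrow> ('a \<Rightarrow> 'a \<Rightarrow> real) \<Rightarrow> 'b set \<Rightarrow> ('b \<Rightarrow> 'b \<Rightarrow> real) \<Rightarrow> ('a \<Rightarrow> 'b) \<Rightarrow> bool" where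
  "isometry_between M d M' d' f \<longleftrightarrow>
     f ` M = M' \<and> (\<forall>x\<in>M. \<forall>y\<in>M. d' (f x) (f y) = d x y)"

text \<open>A subsequence of \<open>r\<close> is \<open>r \<circ> k\<close> with \<open>k\<close> strictly increasing. \<open>em_map r k F'\<close> is the map
  sending the class of \<open>x\<close> to the class of \<open>x \<circ> k\<close> in the identification of \<open>F'\<close>, where \<open>F'\<close> is a
  self-stable family w.r.t. \<open>r \<circ> k\<close>; see \<open>em_map_pt_proj\<close> below.\<close>

definition em_map ::
    "(nat \<Rightarrow> real) \<Rightarrow> (nat \<Rightarrow> nat) \<Rightarrow> (nat \<Rightarrow> 'a::metric_space) set \<Rightarrow>
     (nat \<Rightarrow> 'a) set \<Rightarrow> (nat \<Rightarrow> 'a) set" where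
  "em_map r k F' A = (\<Union>x\<in>A. pt_proj (r \<circ> k) F' (x \<circ> k))"

text \<open>The families \<open>F'\<close> below exist by Zorn's lemma (\<open>ex_maximal_self_stable_superset\<close>), and whether
  \<open>em_map\<close> is an isometry does not depend on which one is taken.\<close>

definition tangent_family ::
    "'a::metric_space set \<Rightarrow> 'a \<Rightarrow> (nat \<Rightarrow> real) \<Rightarrow> (nat \<Rightarrow> 'a) set \<Rightarrow> bool" where
  "tangent_family X a r F \<longleftrightarrow>
     pretangent_family X a r F \<and>
     (\<forall>k F'. strict_mono k \<and> maximal_self_stable X (r \<circ> k) F' \<and> (\<lambda>x. x \<circ> k) ` F \<subseteq> F' \<longrightarrow>
        isometry_between (pt_space r F) (pt_dist r) (pt_space (r \<circ> k) F') (pt_dist (r \<circ> k))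
          (em_map r k F'))"

definition lies_in_tangent_space ::
    "'a::metric_space set \<Rightarrow> 'a \<Rightarrow> (nat \<Rightarrow> real) \<Rightarrow> (nat \<Rightarrow> 'a) set \<Rightarrow> bool" where
  "lies_in_tangent_space X a r F \<longleftrightarrow>
     (\<exists>k F'. strict_mono k \<and> (\<lambda>x. x \<circ> k) ` F \<subseteq> F' \<and> tangent_family X a (r \<circ> k) F')"


section \<open>Strong tangent equivalence\<close>

definition tangent_equivalent ::
    "'a::metric_space set \<Rightarrow> 'a set \<Rightarrow> 'a \<Rightarrow> (nat \<Rightarrow> real) \<Rightarrow> bool" where
  "tangent_equivalent Y Z a r \<longleftrightarrow>
     (\<forall>y1\<in>point_seqs Y. \<forall>z1\<in>point_seqs Z.
        convergent (\<lambda>n. dist (y1 n) a / r n) \<and> convergent (\<lambda>n. dist (z1 n) a / r n) \<longrightarrow>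
        (\<exists>y2\<in>point_seqs Y. \<exists>z2\<in>point_seqs Z.
           (\<lambda>n. dist (y1 n) (z2 n) / r n) \<longlonglongrightarrow> 0 \<and>
           (\<lambda>n. dist (y2 n) (z1 n) / r n) \<longlonglongrightarrow> 0))"

definition strongly_tangent_equivalent ::
    "'a::metric_space set \<Rightarrow> 'a set \<Rightarrow> 'a \<Rightarrow> bool" where
  "strongly_tangent_equivalent Y Z a \<longleftrightarrow>
     a \<in> Y \<and> a \<in> Z \<and> (\<forall>r. normalizing r \<longrightarrow> tangent_equivalent Y Z a r)"


section \<open>Cones and starlike sets\<close>

definition starlike_center :: "'a::real_vector set \<Rightarrow> 'a \<Rightarrow> bool" where
  "starlike_center A a \<longleftrightarrow> (\<forall>b\<in>A. closed_segment a b \<subseteq> A)"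

definition cone_vertex :: "'a::real_vector set \<Rightarrow> 'a \<Rightarrow> bool" where
  "cone_vertex A a \<longleftrightarrow> (\<forall>b\<in>A. {a + t *\<^sub>R (b - a) |t. 0 \<le> t} \<subseteq> A)"


section \<open>Well-definedness\<close>

lemma dtilde_tendsto:
  "mutually_stable r x y \<Longrightarrow> (\<lambda>n. dist (x n) (y n) / r n) \<longlonglongrightarrow> dtilde r x y"
  by (simp add: mutually_stable_def dtilde_def convergent_LIMSEQ_iff)

lemma dtilde_commute: "dtilde r x y = dtilde r y x"
  by (simp add: dtilde_def dist_commute)

lemma dtilde_self: "dtilde r x x = 0"
  by (simp add: dtilde_def)

lemma dtilde_nonneg:
  assumes "\<And>n. 0 < r n" "mutually_stable r x y"
  shows "0 \<le> dtilde r x y"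
proof (rule LIMSEQ_le_const[OF dtilde_tendsto[OF assms(2)]])
  show "\<exists>N. \<forall>n\<ge>N. 0 \<le> dist (x n) (y n) / r n"
    using assms(1) by (simp add: less_imp_le)
qed

lemma dtilde_triangle:
  assumes "\<And>n. 0 < r n" "mutually_stable r x y" "mutually_stable r y z" "mutually_stable r x z"
  shows "dtilde r x z \<le> dtilde r x y + dtilde r y z"
proof (rule LIMSEQ_le[OF dtilde_tendsto tendsto_add[OF dtilde_tendsto dtilde_tendsto]])
  have "dist (x n) (z n) / r n \<le> dist (x n) (y n) / r n + dist (y n) (z n) / r n" for n
    using assms(1)[of n] dist_triangle[of "x n" "z n" "y n"]
    by (simp add: divide_right_mono flip: add_divide_distrib)
  then show "\<exists>N. \<forall>n\<ge>N. dist (x n) (z n) / r n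
      \<le> dist (x n) (y n) / r n + dist (y n) (z n) / r n" by blast
qed (use assms in auto)

context
  fixes r :: "nat \<Rightarrow> real" and F :: "(nat \<Rightarrow> 'a::metric_space) set"
  assumes pos: "\<And>n. 0 < r n" and stable: "self_stable r F"
begin

lemma self_stableD: "x \<in> F \<Longrightarrow> y \<in> F \<Longrightarrow> mutually_stable r x y"
  using stable by (simp add: self_stable_def)

lemma dtilde_tri: "x \<in> F \<Longrightarrow> y \<in> F \<Longrightarrow> z \<in> F \<Longrightarrow> dtilde r x z \<le> dtilde r x y + dtilde r y z"
  by (intro dtilde_triangle pos self_stableD)

lemma equiv_ident_rel: "equiv F (ident_rel r F)"
proof (rule equivI)
  show "ident_rel r F \<subseteq> F \<times> F" by (auto simp: ident_rel_def)
  show "refl_on F (ident_rel r F)" by (auto simp: refl_on_def ident_rel_def dtilde_self)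
  show "sym (ident_rel r F)" by (auto simp: sym_def ident_rel_def dtilde_commute)
  show "trans (ident_rel r F)"
  proof (rule transI)
    fix x y z assume "(x, y) \<in> ident_rel r F" "(y, z) \<in> ident_rel r F"
    then show "(x, z) \<in> ident_rel r F"
      using dtilde_tri[of x y z] dtilde_nonneg[OF pos self_stableD, of x z] by (auto simp: ident_rel_def)
  qed
qed

lemma mem_pt_proj: "y \<in> pt_proj r F x \<longleftrightarrow> x \<in> F \<and> y \<in> F \<and> dtilde r x y = 0"
  by (auto simp: pt_proj_def ident_rel_def)

lemma pt_dist_pt_proj:
  assumes "x \<in> F" "y \<in> F"
  shows "pt_dist r (pt_proj r F x) (pt_proj r F y) = dtilde r x y"
proof -
  have "dtilde r u v = dtilde r x y" if "u \<in> pt_proj r F x" "v \<in> pt_proj r F y" for u v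
    using that assms dtilde_tri[of u x v] dtilde_tri[of x y v] dtilde_tri[of x u y] dtilde_tri[of u v y]
    by (auto simp: mem_pt_proj dtilde_commute[of r u x] dtilde_commute[of r v y])
  then have "\<And>p. p \<in> pt_proj r F x \<times> pt_proj r F y \<Longrightarrow> (case p of (u, v) \<Rightarrow> dtilde r u v) = dtilde r x y"
    by (simp add: mem_Times_iff split_beta)
  moreover have "pt_proj r F x \<times> pt_proj r F y \<noteq> {}"
    using assms mem_pt_proj[of x x] mem_pt_proj[of y y] dtilde_self[of r x] dtilde_self[of r y]
    by (metis SigmaI empty_iff)
  ultimately have "(\<lambda>(u, v). dtilde r u v) ` (pt_proj r F x \<times> pt_proj r F y) = {dtilde r x y}"
    by (simp add: image_constant_conv cong: image_cong)
  then show ?thesis by (simp add: pt_dist_def)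
qed

lemma pt_space_eq: "pt_space r F = pt_proj r F ` F"
  by (auto simp: pt_space_def quotient_def pt_proj_def)

lemma pt_proj_eq_iff:
  "x \<in> F \<Longrightarrow> y \<in> F \<Longrightarrow> pt_proj r F x = pt_proj r F y \<longleftrightarrow> dtilde r x y = 0"
  using eq_equiv_class_iff[OF equiv_ident_rel, of x y] by (auto simp: pt_proj_def ident_rel_def)

end

lemma em_map_pt_proj:
  assumes "\<And>n. 0 < r n" "self_stable r F" "strict_mono k"
    and "self_stable (r \<circ> k) F'" "(\<lambda>x. x \<circ> k) ` F \<subseteq> F'" "x \<in> F"
  shows "em_map r k F' (pt_proj r F x) = pt_proj (r \<circ> k) F' (x \<circ> k)"
proof -
  have "pt_proj (r \<circ> k) F' (y \<circ> k) = pt_proj (r \<circ> k) F' (x \<circ> k)" if y: "y \<in> pt_proj r F x" for y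
  proof -
    have *: "y \<in> F" "dtilde r x y = 0" using y by (auto simp: mem_pt_proj[OF assms(1,2)])
    then have "(\<lambda>n. dist (x n) (y n) / r n) \<longlonglongrightarrow> 0"
      using dtilde_tendsto[OF self_stableD[OF assms(1,2,6)]] by fastforce
    from LIMSEQ_subseq_LIMSEQ[OF this assms(3)]
    have "dtilde (r \<circ> k) (x \<circ> k) (y \<circ> k) = 0"
      by (simp add: dtilde_def limI o_def)
    moreover have "x \<circ> k \<in> F'" "y \<circ> k \<in> F'" using assms(5,6) * by auto
    ultimately show ?thesis
      using pt_proj_eq_iff[of "r \<circ> k" F' "x \<circ> k" "y \<circ> k"] assms(1,4) by simp
  qed
  moreover have "x \<in> pt_proj r F x"
    using assms(6) by (auto simp: mem_pt_proj[OF assms(1,2)] dtilde_self)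
  ultimately show ?thesis unfolding em_map_def by blast
qed

lemma ex_maximal_self_stable_superset:
  assumes "F \<subseteq> point_seqs X" "self_stable r F"
  shows "\<exists>F'. F \<subseteq> F' \<and> maximal_self_stable X r F'"
proof -
  let ?S = "{G. F \<subseteq> G \<and> G \<subseteq> point_seqs X \<and> self_stable r G}"
  have "\<exists>M\<in>?S. \<forall>G\<in>?S. M \<subseteq> G \<longrightarrow> G = M"
  proof (rule subset_Zorn_nonempty)
    show "?S \<noteq> {}" using assms by blast
    fix C assume C: "C \<noteq> {}" "subset.chain ?S C"
    have "self_stable r (\<Union>C)"
      unfolding self_stable_def
    proof (intro ballI)
      fix x y assume "x \<in> \<Union>C" "y \<in> \<Union>C"
      then obtain G H where "G \<in> C" "H \<in> C" "x \<in> G" "y \<in> H" by blast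
      moreover from this have "G \<subseteq> H \<or> H \<subseteq> G"
        using C(2) by (simp add: subset_chain_def)
      ultimately obtain G where "G \<in> C" "x \<in> G" "y \<in> G" by blast
      then show "mutually_stable r x y"
        using C(2) by (auto simp: subset_chain_def self_stable_def)
    qed
    moreover have "\<Union>C \<subseteq> point_seqs X" "F \<subseteq> \<Union>C"
      using C unfolding subset_chain_def by blast+
    ultimately show "\<Union>C \<in> ?S" by blast
  qed
  then obtain M where M: "M \<in> ?S" and max: "\<forall>G\<in>?S. M \<subseteq> G \<longrightarrow> G = M" by (rule bexE)
  have "z \<in> M" if z: "z \<in> point_seqs X" "\<forall>x\<in>M. mutually_stable r x z" for z
  proof -
    have "mutually_stable r z z" by (simp add: mutually_stable_def convergent_const)
    moreover have "mutually_stable r z x" if "x \<in> M" for x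
      using z(2) that by (simp add: mutually_stable_def dist_commute)
    ultimately have "insert z M \<in> ?S" using M(1) z by (auto simp: self_stable_def)
    from max[rule_format, OF this subset_insertI] have "insert z M = M" .
    then show ?thesis by (metis insertI1)
  qed
  then show ?thesis using M(1) unfolding maximal_self_stable_def by blast
qed

end

theory Submission
  imports Defs
begin

text \<open>
  The idea is to look at the rescaled sequences \<open>(x n - a) / r n\<close>. Let \<open>C\<close> be the closed cone
  generated by \<open>S - a\<close>, where \<open>S\<close> is the starlike set. Starlikeness makes \<open>C\<close> the exact set of
  limits of rescaled sequences in \<open>S\<close>, whatever the normalizing sequence \<open>r\<close> is, and strong tangent
  equivalence transfers this property to \<open>X\<close>
  (\<open>has_tangent_cone_if_strongly_tangent_equivalent_starlike\<close>).

  A pretangent family need not consist of sequences with convergent rescalings: only the mutual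
  distances converge, so the rescaled picture may keep moving by isometries fixing the origin.
  In finite dimension, however, finitely many members pin down the isometry, so one subsequence
  makes the rescalings of \<^emph>\<open>all\<close> members converge (\<open>common_convergent_subsequence\<close>).
  Along that subsequence the family sits inside the family of \<^emph>\<open>all\<close> sequences with convergent
  rescaling. The limits of the latter fill \<open>C\<close>, and this has two consequences. First, any sequence
  at stable distance from all of them has a convergent rescaling: a cluster point of the rescaling
  lies in \<open>C\<close>, hence is itself the limit of a member, and the distance to this member
  converges to \<open>0\<close> along a subsequence and therefore altogether (\<open>converges_if_stable_to_cone\<close>).
  Second, taking limits identifies the metric identification with \<open>C\<close>, for this \<open>r\<close> and for all of
  its subsequences alike; so the space is tangent.

  Finally, a tangent space is isometric, through \<open>em_map\<close>, to the space obtained along such a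
  subsequence, and hence to \<open>C\<close>. The cone does not depend on \<open>r\<close>, and the constant sequence \<open>a\<close>
  rescales to the vertex \<open>0\<close>.
\<close>

section \<open>Rescaled sequences\<close>

definition blow_up :: "'a::real_normed_vector \<Rightarrow> (nat \<Rightarrow> real) \<Rightarrow> (nat \<Rightarrow> 'a) \<Rightarrow> nat \<Rightarrow> 'a" where
  "blow_up a r x n = (x n - a) /\<^sub>R r n"

lemma blow_up_comp: "blow_up a (r \<circ> k) (x \<circ> k) = blow_up a r x \<circ> k"
  by (simp add: fun_eq_iff blow_up_def)

lemma blow_up_base: "blow_up a r (\<lambda>n. a) = (\<lambda>n. 0)"
  by (simp add: fun_eq_iff blow_up_def)

lemma dist_blow_up:
  assumes "0 < r n"
  shows "dist (blow_up a r x n) (blow_up a r y n) = dist (x n) (y n) / r n"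
proof -
  have "blow_up a r x n - blow_up a r y n = (x n - y n) /\<^sub>R r n"
    by (simp add: blow_up_def flip: scaleR_diff_right)
  then show ?thesis
    using assms by (simp add: dist_norm divide_inverse_commute)
qed

lemma dist_over_r_tendsto:
  assumes "\<And>n. 0 < r n" "blow_up a r x \<longlonglongrightarrow> p" "blow_up a r y \<longlonglongrightarrow> q"
  shows "(\<lambda>n. dist (x n) (y n) / r n) \<longlonglongrightarrow> dist p q"
  using tendsto_dist[OF assms(2,3)] by (simp add: dist_blow_up assms(1))

lemma mutually_stable_if_blow_up_tendsto:
  assumes "\<And>n. 0 < r n" "blow_up a r x \<longlonglongrightarrow> p" "blow_up a r y \<longlonglongrightarrow> q"
  shows "mutually_stable r x y"
  using dist_over_r_tendsto[OF assms] by (auto simp: mutually_stable_def convergent_def)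

lemma dtilde_eq_dist_limits:
  assumes "\<And>n. 0 < r n" "blow_up a r x \<longlonglongrightarrow> p" "blow_up a r y \<longlonglongrightarrow> q"
  shows "dtilde r x y = dist p q"
  unfolding dtilde_def by (rule limI[OF dist_over_r_tendsto[OF assms]])

lemma blow_up_tendsto_cong:
  assumes "\<And>n. 0 < r n" "blow_up a r x \<longlonglongrightarrow> p" "(\<lambda>n. dist (x n) (y n) / r n) \<longlonglongrightarrow> 0"
  shows "blow_up a r y \<longlonglongrightarrow> p"
proof (rule Lim_transform[OF assms(2)])
  have "dist (x n) (y n) / r n = norm (blow_up a r y n - blow_up a r x n)" for n
    using dist_blow_up[of r n a y x] assms(1) by (simp add: dist_norm norm_minus_commute)
  with assms(3) show "(\<lambda>n. blow_up a r y n - blow_up a r x n) \<longlonglongrightarrow> 0"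
    by (simp add: tendsto_norm_zero_iff)
qed

lemma normalizing_subseq:
  assumes "normalizing r" "strict_mono k"
  shows "normalizing (r \<circ> k)"
  using assms LIMSEQ_subseq_LIMSEQ[of r 0 k] by (simp add: normalizing_def)


section \<open>Tangent cones\<close>

text \<open>The set of limits is required to be the same for every normalizing sequence. For an arbitrary
  \<open>X\<close> it can vary with \<open>r\<close>, and a limit reached along a subsequence of \<open>r\<close> may not be one
  along \<open>r\<close>; the uniformity is what makes passing to subsequences harmless.\<close>

definition has_tangent_cone :: "'a::real_normed_vector set \<Rightarrow> 'a \<Rightarrow> 'a set \<Rightarrow> bool" where
  "has_tangent_cone X a C \<longleftrightarrow>
     (\<forall>r. normalizing r \<longrightarrow> C = {w. \<exists>x\<in>point_seqs X. blow_up a r x \<longlonglongrightarrow> w})"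

definition closed_cone_at :: "'a::real_normed_vector set \<Rightarrow> 'a \<Rightarrow> 'a set" where
  "closed_cone_at S a = closure {t *\<^sub>R (s - a) |t s. 0 \<le> t \<and> s \<in> S}"

lemma closed_closed_cone_at: "closed (closed_cone_at S a)"
  by (simp add: closed_cone_at_def)

lemma cone_vertex_closed_cone_at: "cone_vertex (closed_cone_at S a) 0"
proof -
  let ?K = "{t *\<^sub>R (s - a) |t s. 0 \<le> t \<and> s \<in> S}"
  have "c *\<^sub>R w \<in> closure ?K" if c: "0 \<le> c" and w: "w \<in> closure ?K" for c w
  proof -
    have "c *\<^sub>R v \<in> ?K" if v: "v \<in> ?K" for v
    proof -
      from v obtain t s where "v = t *\<^sub>R (s - a)" "0 \<le> t" "s \<in> S" by blast
      then have "c *\<^sub>R v = (c * t) *\<^sub>R (s - a)" "0 \<le> c * t" using c by auto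
      then show ?thesis using \<open>s \<in> S\<close> by blast
    qed
    then have "(*\<^sub>R) c ` ?K \<subseteq> ?K" by blast
    then have "closure ((*\<^sub>R) c ` ?K) \<subseteq> closure ?K" by (rule closure_mono)
    then have "(*\<^sub>R) c ` closure ?K \<subseteq> closure ?K" by (simp only: closure_scaleR)
    with w show ?thesis by blast
  qed
  then show ?thesis by (auto simp: cone_vertex_def closed_cone_at_def)
qed

lemma blow_up_limit_in_closed_cone:
  assumes "\<And>n. 0 < r n" "z \<in> point_seqs S" "blow_up a r z \<longlonglongrightarrow> w"
  shows "w \<in> closed_cone_at S a"
proof -
  have "blow_up a r z n \<in> {t *\<^sub>R (s - a) |t s. 0 \<le> t \<and> s \<in> S}" for n
    using assms(1)[of n] assms(2)
    by (auto simp: blow_up_def point_seqs_def intro!: exI[of _ "inverse (r n)"] exI[of _ "z n"])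
  then show ?thesis
    unfolding closed_cone_at_def closure_sequential using assms(3) by blast
qed

text \<open>For a point \<open>t (s - a)\<close> of the cone, \<open>a + t r\<^sub>n (s - a)\<close> lies on the segment from \<open>a\<close> to \<open>s\<close>
  as soon as \<open>t r\<^sub>n \<le> 1\<close>, and it rescales to \<open>t (s - a)\<close>. So the distance from a point of the closed
  cone to the rescaled set \<open>S\<close> tends to \<open>0\<close>, and near-minimizers form the sequence wanted.\<close>

lemma ex_blow_up_tendsto_if_starlike:
  assumes S: "starlike_center S a" "a \<in> S" and r: "normalizing r" and w: "w \<in> closed_cone_at S a"
  shows "\<exists>z\<in>point_seqs S. blow_up a r z \<longlonglongrightarrow> w"
proof -
  have rpos: "0 < r n" for n using r by (simp add: normalizing_def)
  define D where "D n = (\<lambda>s. (s - a) /\<^sub>R r n) ` S" for n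
  have D_ne: "D n \<noteq> {}" for n using S(2) by (auto simp: D_def)
  have D0: "(\<lambda>n. infdist w (D n)) \<longlonglongrightarrow> 0"
  proof (rule LIMSEQ_I)
    fix e :: real assume "0 < e"
    with w obtain t s where ts: "0 \<le> t" "s \<in> S" "dist (t *\<^sub>R (s - a)) w < e"
      unfolding closed_cone_at_def closure_approachable by blast
    have "(\<lambda>n. t * r n) \<longlonglongrightarrow> t * 0"
      using r by (intro tendsto_intros) (simp add: normalizing_def)
    then have "eventually (\<lambda>n. t * r n < 1) sequentially"
      by (rule order_tendstoD) simp
    then obtain N where N: "\<And>n. n \<ge> N \<Longrightarrow> t * r n < 1"
      by (auto simp: eventually_sequentially)
    have "infdist w (D n) < e" if "n \<ge> N" for n
    proof -
      have "a + (t * r n) *\<^sub>R (s - a) \<in> closed_segment a s"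
        using N[OF that] ts(1) rpos[of n]
        by (auto simp: in_segment algebra_simps intro!: exI[of _ "t * r n"])
      then have "a + (t * r n) *\<^sub>R (s - a) \<in> S"
        using S(1) ts(2) by (auto simp: starlike_center_def)
      then have "((a + (t * r n) *\<^sub>R (s - a)) - a) /\<^sub>R r n \<in> D n"
        unfolding D_def by (rule imageI)
      moreover have "((a + (t * r n) *\<^sub>R (s - a)) - a) /\<^sub>R r n = t *\<^sub>R (s - a)"
        using rpos[of n] by simp
      ultimately have "infdist w (D n) \<le> dist w (t *\<^sub>R (s - a))"
        by (metis infdist_le)
      with ts(3) show ?thesis by (simp add: dist_commute)
    qed
    then show "\<exists>N. \<forall>n\<ge>N. norm (infdist w (D n) - 0) < e"
      by (auto simp: infdist_nonneg)
  qed
  have "\<exists>s. s \<in> S \<and> dist w ((s - a) /\<^sub>R r n) < infdist w (D n) + r n" for n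
  proof -
    \<comment> \<open>The slack \<open>r n\<close> is any positive null sequence.\<close>
    have "(INF v\<in>D n. dist w v) < infdist w (D n) + r n"
      using rpos[of n] D_ne[of n] by (simp add: infdist_notempty)
    then obtain v where "v \<in> D n" "dist w v < infdist w (D n) + r n"
      using D_ne[of n] by (subst (asm) cInf_less_iff) auto
    then show ?thesis by (auto simp: D_def)
  qed
  then obtain z where z: "\<And>n. z n \<in> S" "\<And>n. dist w ((z n - a) /\<^sub>R r n) < infdist w (D n) + r n"
    by metis
  have null: "(\<lambda>n. infdist w (D n) + r n) \<longlonglongrightarrow> 0"
    using tendsto_add[OF D0, of r 0] r by (simp add: normalizing_def)
  have "norm (dist (blow_up a r z n) w) \<le> infdist w (D n) + r n" for n
    using z(2)[of n] by (simp add: blow_up_def dist_commute)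
  then have "eventually (\<lambda>n. norm (dist (blow_up a r z n) w) \<le> infdist w (D n) + r n) sequentially"
    by (rule always_eventually[OF allI])
  from Lim_null_comparison[OF this null] have "(\<lambda>n. dist (blow_up a r z n) w) \<longlonglongrightarrow> 0" .
  then have "blow_up a r z \<longlonglongrightarrow> w" by (rule tendsto_dist_iff[THEN iffD2])
  with z(1) show ?thesis by (auto simp: point_seqs_def)
qed

lemma has_tangent_cone_if_strongly_tangent_equivalent_starlike:
  assumes S: "starlike_center S a" and eq: "strongly_tangent_equivalent X S a"
  shows "has_tangent_cone X a (closed_cone_at S a)"
  unfolding has_tangent_cone_def
proof (intro allI impI set_eqI iffI)
  fix r w assume r: "normalizing r"
  then have rpos: "\<And>n. 0 < r n" by (simp add: normalizing_def)
  have aX: "(\<lambda>n. a) \<in> point_seqs X" and aS: "(\<lambda>n. a) \<in> point_seqs S" and "a \<in> S"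
    and te: "tangent_equivalent X S a r"
    using eq r by (auto simp: strongly_tangent_equivalent_def point_seqs_def)
  have conv: "convergent (\<lambda>n. dist (x n) a / r n)" if "blow_up a r x \<longlonglongrightarrow> w" for x
    using dist_over_r_tendsto[OF rpos that, of "\<lambda>n. a" 0] by (auto simp: blow_up_base convergent_def)
  have conv0: "convergent (\<lambda>n. dist a a / r n)" by (simp add: convergent_const)
  show "w \<in> {w. \<exists>x\<in>point_seqs X. blow_up a r x \<longlonglongrightarrow> w}" if w: "w \<in> closed_cone_at S a"
  proof -
    obtain z where z: "z \<in> point_seqs S" "blow_up a r z \<longlonglongrightarrow> w"
      using ex_blow_up_tendsto_if_starlike[OF S \<open>a \<in> S\<close> r w] by blast
    then obtain y where "y \<in> point_seqs X" "(\<lambda>n. dist (y n) (z n) / r n) \<longlonglongrightarrow> 0"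
      using te[unfolded tangent_equivalent_def, rule_format, OF aX z(1)] conv conv0 by blast
    then show ?thesis
      using blow_up_tendsto_cong[OF rpos z(2), of y] by (auto simp: dist_commute)
  qed
  show "w \<in> closed_cone_at S a" if "w \<in> {w. \<exists>x\<in>point_seqs X. blow_up a r x \<longlonglongrightarrow> w}"
  proof -
    from that obtain x where x: "x \<in> point_seqs X" "blow_up a r x \<longlonglongrightarrow> w" by blast
    then obtain z where "z \<in> point_seqs S" "(\<lambda>n. dist (x n) (z n) / r n) \<longlonglongrightarrow> 0"
      using te[unfolded tangent_equivalent_def, rule_format, OF x(1) aS] conv conv0 by blast
    then show ?thesis
      using blow_up_limit_in_closed_cone[of r z S a w] blow_up_tendsto_cong[of r a x w z] rpos x(2)
      by blast
  qed
qed


section \<open>A common convergent subsequence\<close>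

lemma convergent_power2:
  fixes f :: "nat \<Rightarrow> real"
  shows "convergent f \<Longrightarrow> convergent (\<lambda>n. (f n)\<^sup>2)"
  by (simp add: power2_eq_square convergent_mult)

text \<open>If \<open>v\<close> converges to \<open>l\<close> and \<open>u \<bullet> v\<close> converges, then so does \<open>u \<bullet> l\<close>, and this extends
  linearly to all \<open>w\<close> in the span of such limits. If \<open>w\<close> is moreover a cluster point of \<open>u\<close>, then
  the squared distance of \<open>u\<close> to \<open>w\<close>, which expands into convergent terms, converges to \<open>0\<close>.\<close>

lemma tendsto_cluster_point_in_span:
  fixes u :: "nat \<Rightarrow> 'a::real_inner"
  assumes norm_conv: "convergent (\<lambda>n. norm (u n))"
    and L: "\<And>l. l \<in> L \<Longrightarrow> \<exists>v. v \<longlonglongrightarrow> l \<and> convergent (\<lambda>n. u n \<bullet> v n)"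
    and w: "w \<in> span L" and k: "strict_mono k" "(u \<circ> k) \<longlonglongrightarrow> w"
  shows "u \<longlonglongrightarrow> w"
proof -
  have bdd: "Bseq u"
    using convergent_imp_Bseq[OF norm_conv] by (simp add: Bseq_def)
  have gen: "convergent (\<lambda>n. u n \<bullet> l)" if "l \<in> L" for l
  proof -
    from L[OF that] obtain v where v: "v \<longlonglongrightarrow> l" "convergent (\<lambda>n. u n \<bullet> v n)" by blast
    have "Zfun (\<lambda>n. v n - l) sequentially"
      using v(1) by (simp add: tendsto_Zfun_iff)
    then have "Zfun (\<lambda>n. u n \<bullet> (v n - l)) sequentially"
      using bdd by (rule bounded_bilinear.Bfun_prod_Zfun[OF bounded_bilinear_inner, rotated])
    then have "convergent (\<lambda>n. u n \<bullet> (v n - l))"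
      by (auto simp: convergent_def tendsto_Zfun_iff intro!: exI[of _ 0])
    from convergent_diff[OF v(2) this] show ?thesis by (simp add: inner_diff_right)
  qed
  have "subspace {v. convergent (\<lambda>n. u n \<bullet> v)}"
    by (auto simp: subspace_def inner_add_right convergent_const
        intro: convergent_add convergent_mult)
  then have "convergent (\<lambda>n. u n \<bullet> w)"
    using span_minimal[of L "{v. convergent (\<lambda>n. u n \<bullet> v)}"] gen w by blast
  then have "convergent (\<lambda>n. norm (u n) ^ 2 - 2 * (u n \<bullet> w) + norm w ^ 2)"
    using norm_conv
    by (intro convergent_add convergent_diff convergent_mult convergent_power2 convergent_const)
  moreover have "norm (u n - w) ^ 2 = norm (u n) ^ 2 - 2 * (u n \<bullet> w) + norm w ^ 2" for n
    by (simp add: power2_norm_eq_inner inner_diff inner_commute)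
  ultimately obtain d where d: "(\<lambda>n. norm (u n - w) ^ 2) \<longlonglongrightarrow> d"
    by (auto simp: convergent_def)
  have "(\<lambda>n. norm ((u \<circ> k) n - w) ^ 2) \<longlonglongrightarrow> norm (w - w) ^ 2"
    by (intro tendsto_intros k(2))
  moreover have "(\<lambda>n. norm ((u \<circ> k) n - w) ^ 2) \<longlonglongrightarrow> d"
    using LIMSEQ_subseq_LIMSEQ[OF d k(1)] by (simp add: o_def)
  ultimately have "norm (w - w) ^ 2 = d" by (rule LIMSEQ_unique)
  then have "d = 0" by simp
  with tendsto_real_sqrt[OF d] show ?thesis
    by (simp add: LIM_zero_iff tendsto_norm_zero_iff)
qed

text \<open>Among all subsequences, take one along which the limits of the convergent members span a space
  of the greatest dimension. A member that still diverges could be made to converge along a further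
  subsequence; its limit would lie in the span already reached, and this forces convergence along
  the first subsequence.\<close>

lemma common_convergent_subsequence:
  fixes U :: "(nat \<Rightarrow> 'a::euclidean_space) set"
  assumes inner_conv: "\<And>u v. u \<in> U \<Longrightarrow> v \<in> U \<Longrightarrow> convergent (\<lambda>n. u n \<bullet> v n)"
  shows "\<exists>k :: nat \<Rightarrow> nat. strict_mono k \<and> (\<forall>u\<in>U. convergent (u \<circ> k))"
proof -
  define L where "L k = {l. \<exists>u\<in>U. (u \<circ> k) \<longlonglongrightarrow> l}" for k :: "nat \<Rightarrow> nat"
  have "\<exists>k. strict_mono k \<and> (\<forall>k'. strict_mono k' \<longrightarrow> dim (L k') \<le> dim (L k))"
    by (rule ex_has_greatest_nat[where b = "Suc DIM('a)" and k = id])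
      (auto simp: strict_mono_id dim_subset_UNIV le_imp_less_Suc)
  then obtain k where k: "strict_mono k"
    and max: "\<And>k'. strict_mono k' \<Longrightarrow> dim (L k') \<le> dim (L k)" by blast
  have inner_conv_k: "convergent (\<lambda>n. (u \<circ> k) n \<bullet> (v \<circ> k) n)" if "u \<in> U" "v \<in> U" for u v
    using convergent_subseq_convergent[OF inner_conv[OF that] k] by (simp add: o_def)
  have "convergent (u \<circ> k)" if u: "u \<in> U" for u
  proof -
    obtain s where "(\<lambda>n. (u \<circ> k) n \<bullet> (u \<circ> k) n) \<longlonglongrightarrow> s"
      using inner_conv_k[OF u u] by (auto simp: convergent_def)
    from tendsto_real_sqrt[OF this] have norm_conv: "convergent (\<lambda>n. norm ((u \<circ> k) n))"
      by (auto simp: norm_eq_sqrt_inner convergent_def)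
    then have "bounded (range (u \<circ> k))"
      using convergent_imp_Bseq[OF norm_conv] by (simp add: Bseq_def flip: Bseq_eq_bounded)
    then obtain w h where h: "strict_mono h" and w: "((u \<circ> k) \<circ> h) \<longlonglongrightarrow> w"
      using bounded_imp_convergent_subsequence by blast
    have sub: "L k \<subseteq> L (k \<circ> h)"
      using LIMSEQ_subseq_LIMSEQ[OF _ h] by (fastforce simp: L_def o_assoc)
    have w_in: "w \<in> L (k \<circ> h)" using w u by (auto simp: L_def o_assoc)
    have "dim (insert w (L k)) \<le> dim (L (k \<circ> h))"
      using sub w_in by (intro dim_subset) blast
    also have "\<dots> \<le> dim (L k)" using k h by (intro max strict_mono_o)
    finally have "w \<in> span (L k)" by (auto simp: dim_insert split: if_splits)
    moreover have "\<exists>v. v \<longlonglongrightarrow> l \<and> convergent (\<lambda>n. (u \<circ> k) n \<bullet> v n)" if "l \<in> L k" for l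
      using that inner_conv_k[OF u] unfolding L_def by blast
    ultimately have "(u \<circ> k) \<longlonglongrightarrow> w"
      using tendsto_cluster_point_in_span[OF norm_conv _ _ h w, of "L k"] by blast
    then show ?thesis by (auto simp: convergent_def)
  qed
  with k show ?thesis by blast
qed

lemma blow_ups_common_convergent_subsequence:
  fixes a :: "'a::euclidean_space"
  assumes rpos: "\<And>n. 0 < r n" and F: "self_stable r F" "(\<lambda>n. a) \<in> F"
  shows "\<exists>k. strict_mono k \<and> (\<forall>x\<in>F. convergent (blow_up a r x \<circ> k))"
proof -
  have dist_conv: "convergent (\<lambda>n. dist (blow_up a r x n) (blow_up a r y n))"
    if "x \<in> F" "y \<in> F" for x y
    using self_stableD[OF rpos F(1) that] by (simp add: mutually_stable_def dist_blow_up rpos)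
  have norm_conv: "convergent (\<lambda>n. norm (blow_up a r x n))" if "x \<in> F" for x
    using dist_conv[OF that F(2)] by (simp add: blow_up_base)
  have "convergent (\<lambda>n. blow_up a r x n \<bullet> blow_up a r y n)" if "x \<in> F" "y \<in> F" for x y
  proof -
    \<comment> \<open>Polarization: distances among two members and the base point determine the inner product.\<close>
    have "blow_up a r x n \<bullet> blow_up a r y n =
      ((norm (blow_up a r x n))\<^sup>2 + (norm (blow_up a r y n))\<^sup>2
        - (dist (blow_up a r x n) (blow_up a r y n))\<^sup>2) / 2" for n
      unfolding dist_norm by (rule dot_norm_neg)
    moreover have "convergent (\<lambda>n. ((norm (blow_up a r x n))\<^sup>2 + (norm (blow_up a r y n))\<^sup>2
        - (dist (blow_up a r x n) (blow_up a r y n))\<^sup>2) / 2)"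
      unfolding divide_inverse
      by (intro convergent_mult convergent_add convergent_diff convergent_power2 convergent_const
          norm_conv dist_conv that)
    ultimately show ?thesis by (simp only:)
  qed
  then show ?thesis
    using common_convergent_subsequence[of "blow_up a r ` F"] by auto
qed


section \<open>Families whose limits fill the tangent cone\<close>

text \<open>A cluster point \<open>p\<close> of the rescaling of \<open>z\<close> lies in \<open>C\<close>, by the defining property of \<open>C\<close> for the
  subsequence. Comparing \<open>z\<close> with a sequence \<open>y\<close> that reaches \<open>p\<close>, the stable distance to \<open>y\<close> has to
  be \<open>0\<close>. Boundedness, which provides the cluster point, comes from the comparison at the vertex.\<close>

lemma converges_if_stable_to_cone:
  fixes a :: "'a::euclidean_space"
  assumes X: "has_tangent_cone X a C" "a \<in> X" and r: "normalizing r" and z: "z \<in> point_seqs X"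
    and stable: "\<And>w. w \<in> C \<Longrightarrow> \<exists>y. blow_up a r y \<longlonglongrightarrow> w \<and> mutually_stable r y z"
  shows "\<exists>p\<in>C. blow_up a r z \<longlonglongrightarrow> p"
proof -
  have rpos: "\<And>n. 0 < r n" using r by (simp add: normalizing_def)
  have dist_conv: "convergent (\<lambda>n. dist (blow_up a r y n) (blow_up a r z n))"
    if "mutually_stable r y z" for y
    using that by (simp add: mutually_stable_def dist_blow_up rpos)
  have C_eq: "C = {w. \<exists>x\<in>point_seqs X. blow_up a s x \<longlonglongrightarrow> w}" if "normalizing s" for s
    using X(1) that by (simp add: has_tangent_cone_def)
  have "(\<lambda>n. a) \<in> point_seqs X" using X(2) by (simp add: point_seqs_def)
  then have "0 \<in> C" using C_eq[OF r] by (auto simp: blow_up_base intro: bexI[of _ "\<lambda>n. a"])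
  then obtain y where y: "blow_up a r y \<longlonglongrightarrow> 0" "mutually_stable r y z"
    using stable by blast
  have "bounded (range (blow_up a r z))"
  proof -
    obtain A where A: "\<And>n. norm (blow_up a r y n) \<le> A"
      using convergent_imp_Bseq[OF convergentI[OF y(1)]] by (auto simp: Bseq_def)
    obtain B where B: "\<And>n. dist (blow_up a r y n) (blow_up a r z n) \<le> B"
      using convergent_imp_Bseq[OF dist_conv[OF y(2)]] by (auto simp: Bseq_def)
    have "norm (blow_up a r z n) \<le> A + B" for n
      using A[of n] B[of n] norm_triangle_sub[of "blow_up a r z n" "blow_up a r y n"]
      by (simp add: dist_norm norm_minus_commute)
    then show ?thesis by (auto simp: bounded_iff)
  qed
  then obtain p k where k: "strict_mono k" and p: "(blow_up a r z \<circ> k) \<longlonglongrightarrow> p"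
    using bounded_imp_convergent_subsequence by blast
  have "z \<circ> k \<in> point_seqs X" using z by (simp add: point_seqs_def)
  with p have "p \<in> C"
    using C_eq[OF normalizing_subseq[OF r k]] by (auto simp flip: blow_up_comp)
  then obtain y where y: "blow_up a r y \<longlonglongrightarrow> p" "mutually_stable r y z"
    using stable by blast
  then obtain d where d: "(\<lambda>n. dist (blow_up a r y n) (blow_up a r z n)) \<longlonglongrightarrow> d"
    using dist_conv by (auto simp: convergent_def)
  have "(\<lambda>n. dist ((blow_up a r y \<circ> k) n) ((blow_up a r z \<circ> k) n)) \<longlonglongrightarrow> dist p p"
    by (intro tendsto_dist p LIMSEQ_subseq_LIMSEQ[OF y(1) k])
  moreover have "(\<lambda>n. dist ((blow_up a r y \<circ> k) n) ((blow_up a r z \<circ> k) n)) \<longlonglongrightarrow> d"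
    using LIMSEQ_subseq_LIMSEQ[OF d k] by (simp add: o_def)
  ultimately have "dist p p = d" by (rule LIMSEQ_unique)
  then have "d = 0" by simp
  with d have "(\<lambda>n. dist (y n) (z n) / r n) \<longlonglongrightarrow> 0" by (simp add: dist_blow_up rpos)
  from blow_up_tendsto_cong[OF rpos y(1) this] \<open>p \<in> C\<close> show ?thesis by blast
qed

definition fills_cone ::
    "'a::real_normed_vector set \<Rightarrow> 'a \<Rightarrow> (nat \<Rightarrow> real) \<Rightarrow> 'a set \<Rightarrow> (nat \<Rightarrow> 'a) set \<Rightarrow> bool" where
  "fills_cone X a r C F \<longleftrightarrow>
     F \<subseteq> point_seqs X \<and> self_stable r F \<and> (\<forall>w\<in>C. \<exists>y\<in>F. blow_up a r y \<longlonglongrightarrow> w)"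

text \<open>The common limit of the rescalings of the representatives of the class \<open>A\<close>.\<close>

definition class_limit ::
    "'a::real_normed_vector \<Rightarrow> (nat \<Rightarrow> real) \<Rightarrow> (nat \<Rightarrow> 'a) set \<Rightarrow> 'a" where
  "class_limit a r A = the_elem ((\<lambda>x. lim (blow_up a r x)) ` A)"

lemma class_limit_pt_proj:
  assumes rpos: "\<And>n. 0 < r n" and F: "self_stable r F" and x: "x \<in> F" "blow_up a r x \<longlonglongrightarrow> p"
  shows "class_limit a r (pt_proj r F x) = p"
proof -
  have "lim (blow_up a r y) = p" if "y \<in> pt_proj r F x" for y
  proof -
    have "y \<in> F" "dtilde r x y = 0" using that by (auto simp: mem_pt_proj[OF rpos F])
    then have "(\<lambda>n. dist (x n) (y n) / r n) \<longlonglongrightarrow> 0"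
      using dtilde_tendsto[OF self_stableD[OF rpos F x(1)]] by fastforce
    then show ?thesis using blow_up_tendsto_cong[OF rpos x(2)] limI by blast
  qed
  moreover have "x \<in> pt_proj r F x" by (simp add: mem_pt_proj[OF rpos F] x(1) dtilde_self)
  ultimately have "(\<lambda>y. lim (blow_up a r y)) ` pt_proj r F x = {p}" by force
  then show ?thesis by (simp add: class_limit_def)
qed

lemma fills_cone_converges:
  fixes a :: "'a::euclidean_space"
  assumes X: "has_tangent_cone X a C" "a \<in> X" and r: "normalizing r"
    and F: "fills_cone X a r C F" and z: "z \<in> F"
  shows "\<exists>p\<in>C. blow_up a r z \<longlonglongrightarrow> p"
proof (rule converges_if_stable_to_cone[OF X r])
  show "z \<in> point_seqs X" using F z by (auto simp: fills_cone_def)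
  show "\<exists>y. blow_up a r y \<longlonglongrightarrow> w \<and> mutually_stable r y z" if "w \<in> C" for w
    using F z that unfolding fills_cone_def self_stable_def by blast
qed

lemma isometry_class_limit:
  fixes a :: "'a::euclidean_space"
  assumes X: "has_tangent_cone X a C" "a \<in> X" and r: "normalizing r"
    and F: "fills_cone X a r C F"
  shows "isometry_between (pt_space r F) (pt_dist r) C dist (class_limit a r)"
proof -
  have rpos: "\<And>n. 0 < r n" using r by (simp add: normalizing_def)
  have st: "self_stable r F" and full: "\<And>w. w \<in> C \<Longrightarrow> \<exists>y\<in>F. blow_up a r y \<longlonglongrightarrow> w"
    using F by (auto simp: fills_cone_def)
  note conv = fills_cone_converges[OF X r F]
  note lim = class_limit_pt_proj[OF rpos st]
  show ?thesis
    unfolding isometry_between_def pt_space_eq[OF rpos st]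
  proof (intro conjI ballI)
    show "class_limit a r ` pt_proj r F ` F = C"
    proof (intro equalityI subsetI)
      fix w assume "w \<in> class_limit a r ` pt_proj r F ` F"
      then show "w \<in> C" using conv lim by force
    next
      fix w assume "w \<in> C"
      then obtain y where "y \<in> F" "blow_up a r y \<longlonglongrightarrow> w" using full by blast
      then show "w \<in> class_limit a r ` pt_proj r F ` F" using lim by force
    qed
    fix A B assume "A \<in> pt_proj r F ` F" "B \<in> pt_proj r F ` F"
    then obtain x y where xy: "x \<in> F" "y \<in> F" "A = pt_proj r F x" "B = pt_proj r F y" by blast
    obtain p q where "blow_up a r x \<longlonglongrightarrow> p" "blow_up a r y \<longlonglongrightarrow> q"
      using conv xy by blast
    then show "dist (class_limit a r A) (class_limit a r B) = pt_dist r A B"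
      using xy by (simp add: lim pt_dist_pt_proj[OF rpos st] dtilde_eq_dist_limits[OF rpos])
  qed
qed

text \<open>The filling property passes to any larger self-stable family along a subsequence; so a member
  of such a family has a limit in \<open>C\<close>, and this is already the limit of a member of \<open>F\<close>.\<close>

lemma tangent_family_if_fills_cone:
  fixes a :: "'a::euclidean_space"
  assumes X: "has_tangent_cone X a C" "a \<in> X" and r: "normalizing r"
    and F: "fills_cone X a r C F" and pre: "pretangent_family X a r F"
  shows "tangent_family X a r F"
  unfolding tangent_family_def
proof (intro conjI pre allI impI, elim conjE)
  fix k F' assume k: "strict_mono k" and max': "maximal_self_stable X (r \<circ> k) F'"
    and sub: "(\<lambda>x. x \<circ> k) ` F \<subseteq> F'"
  have rpos: "\<And>n. 0 < r n" and rkpos: "\<And>n. 0 < (r \<circ> k) n"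
    using r by (auto simp: normalizing_def)
  note rk = normalizing_subseq[OF r k]
  have st: "self_stable r F" and st': "self_stable (r \<circ> k) F'"
    using F max' by (auto simp: fills_cone_def maximal_self_stable_def)
  have full: "\<exists>y\<in>F. blow_up a r y \<longlonglongrightarrow> w" if "w \<in> C" for w
    using F that by (auto simp: fills_cone_def)
  have limk: "blow_up a (r \<circ> k) (y \<circ> k) \<longlonglongrightarrow> p" if "blow_up a r y \<longlonglongrightarrow> p" for y p
    using LIMSEQ_subseq_LIMSEQ[OF that k] by (simp add: blow_up_comp)
  have "\<exists>y\<in>F'. blow_up a (r \<circ> k) y \<longlonglongrightarrow> w" if "w \<in> C" for w
    using full[OF that] limk sub by blast
  then have F': "fills_cone X a (r \<circ> k) C F'"
    using max' by (auto simp: fills_cone_def maximal_self_stable_def)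
  note em = em_map_pt_proj[OF rpos st k st' sub]
  have memk: "y \<circ> k \<in> F'" if "y \<in> F" for y using sub that by blast
  show "isometry_between (pt_space r F) (pt_dist r) (pt_space (r \<circ> k) F') (pt_dist (r \<circ> k))
          (em_map r k F')"
    unfolding isometry_between_def pt_space_eq[OF rpos st] pt_space_eq[OF rkpos st']
  proof (intro conjI ballI)
    show "em_map r k F' ` pt_proj r F ` F = pt_proj (r \<circ> k) F' ` F'"
    proof (intro equalityI subsetI)
      fix A assume "A \<in> em_map r k F' ` pt_proj r F ` F"
      then show "A \<in> pt_proj (r \<circ> k) F' ` F'" using em memk by auto
    next
      fix A assume "A \<in> pt_proj (r \<circ> k) F' ` F'"
      then obtain z where z: "z \<in> F'" "A = pt_proj (r \<circ> k) F' z" by blast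
      obtain p where p: "p \<in> C" "blow_up a (r \<circ> k) z \<longlonglongrightarrow> p"
        using fills_cone_converges[OF X rk F' z(1)] by blast
      obtain y where y: "y \<in> F" "blow_up a r y \<longlonglongrightarrow> p" using full[OF p(1)] by blast
      have "dtilde (r \<circ> k) (y \<circ> k) z = 0"
        using dtilde_eq_dist_limits[OF rkpos limk[OF y(2)] p(2)] by simp
      then have "A = em_map r k F' (pt_proj r F y)"
        using z y(1) pt_proj_eq_iff[OF rkpos st' memk[OF y(1)] z(1)] by (simp add: em)
      then show "A \<in> em_map r k F' ` pt_proj r F ` F" using y(1) by blast
    qed
    fix A B assume "A \<in> pt_proj r F ` F" "B \<in> pt_proj r F ` F"
    then obtain x y where xy: "x \<in> F" "y \<in> F" "A = pt_proj r F x" "B = pt_proj r F y" by blast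
    obtain p q where pq: "blow_up a r x \<longlonglongrightarrow> p" "blow_up a r y \<longlonglongrightarrow> q"
      using fills_cone_converges[OF X r F] xy by blast
    have "dtilde (r \<circ> k) (x \<circ> k) (y \<circ> k) = dtilde r x y"
      using dtilde_eq_dist_limits[OF rpos pq]
        dtilde_eq_dist_limits[OF rkpos limk[OF pq(1)] limk[OF pq(2)]] by simp
    then show "pt_dist (r \<circ> k) (em_map r k F' A) (em_map r k F' B) = pt_dist r A B"
      using xy by (simp add: em pt_dist_pt_proj[OF rpos st] pt_dist_pt_proj[OF rkpos st'] memk)
  qed
qed


section \<open>The family of all convergent rescalings\<close>

definition convergent_family ::
    "'a::real_normed_vector set \<Rightarrow> 'a \<Rightarrow> (nat \<Rightarrow> real) \<Rightarrow> (nat \<Rightarrow> 'a) set" where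
  "convergent_family X a r = {x \<in> point_seqs X. convergent (blow_up a r x)}"

lemma fills_cone_convergent_family:
  assumes "has_tangent_cone X a C" "normalizing r"
  shows "fills_cone X a r C (convergent_family X a r)"
proof -
  have "\<And>n. 0 < r n" using assms(2) by (simp add: normalizing_def)
  then have "self_stable r (convergent_family X a r)"
    by (auto simp: self_stable_def convergent_family_def convergent_def
        intro: mutually_stable_if_blow_up_tendsto)
  moreover have "C = {w. \<exists>x\<in>point_seqs X. blow_up a r x \<longlonglongrightarrow> w}"
    using assms by (simp add: has_tangent_cone_def)
  ultimately show ?thesis
    by (auto simp: fills_cone_def convergent_family_def convergent_def)
qed

lemma tangent_family_convergent_family:
  fixes a :: "'a::euclidean_space"
  assumes X: "has_tangent_cone X a C" "a \<in> X" and r: "normalizing r"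
  shows "tangent_family X a r (convergent_family X a r)"
proof (rule tangent_family_if_fills_cone[OF X r])
  let ?G = "convergent_family X a r"
  show fills: "fills_cone X a r C ?G" by (rule fills_cone_convergent_family[OF X(1) r])
  have "z \<in> ?G" if z: "z \<in> point_seqs X" "\<And>x. x \<in> ?G \<Longrightarrow> mutually_stable r x z" for z
  proof -
    have "\<exists>p\<in>C. blow_up a r z \<longlonglongrightarrow> p"
      by (rule converges_if_stable_to_cone[OF X r z(1)])
        (use fills z(2) in \<open>unfold fills_cone_def, blast\<close>)
    then show ?thesis using z(1) by (auto simp: convergent_family_def convergent_def)
  qed
  moreover have "(\<lambda>n. a) \<in> ?G"
    using X(2) by (simp add: convergent_family_def point_seqs_def blow_up_base convergent_const)
  ultimately show "pretangent_family X a r ?G"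
    using fills unfolding pretangent_family_def maximal_self_stable_def fills_cone_def by blast
qed

lemma pretangent_family_subseq_in_convergent_family:
  fixes a :: "'a::euclidean_space"
  assumes r: "normalizing r" and F: "pretangent_family X a r F"
  obtains k where "strict_mono k" "(\<lambda>x. x \<circ> k) ` F \<subseteq> convergent_family X a (r \<circ> k)"
proof -
  have rpos: "\<And>n. 0 < r n" using r by (simp add: normalizing_def)
  have F': "F \<subseteq> point_seqs X" "self_stable r F" "(\<lambda>n. a) \<in> F"
    using F by (auto simp: pretangent_family_def maximal_self_stable_def)
  obtain k where "strict_mono k" "\<And>x. x \<in> F \<Longrightarrow> convergent (blow_up a r x \<circ> k)"
    using blow_ups_common_convergent_subsequence[OF rpos F'(2,3)] by blast
  with F'(1) show thesis
    by (intro that[of k]) (auto simp: convergent_family_def blow_up_comp point_seqs_def)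
qed

lemma lies_in_tangent_space_if_has_tangent_cone:
  fixes a :: "'a::euclidean_space"
  assumes X: "has_tangent_cone X a C" "a \<in> X" and r: "normalizing r"
    and F: "pretangent_family X a r F"
  shows "lies_in_tangent_space X a r F"
  using pretangent_family_subseq_in_convergent_family[OF r F]
    tangent_family_convergent_family[OF X normalizing_subseq[OF r]]
  unfolding lies_in_tangent_space_def by metis

lemma isometry_between_comp:
  assumes "isometry_between M d M' d' f" "isometry_between M' d' M'' d'' g"
  shows "isometry_between M d M'' d'' (g \<circ> f)"
  using assms by (auto simp: isometry_between_def)

text \<open>The rescalings of a tangent family itself may fail to converge, so the isometry first moves
  to a subsequence along which they do; this is harmless because the space is tangent.\<close>

lemma tangent_space_isometric_to_cone:
  fixes a :: "'a::euclidean_space"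
  assumes X: "has_tangent_cone X a C" "a \<in> X" and r: "normalizing r"
    and F: "tangent_family X a r F"
  shows "\<exists>\<psi>. isometry_between (pt_space r F) (pt_dist r) C dist \<psi> \<and> \<psi> (pt_proj r F (\<lambda>n. a)) = 0"
proof -
  have pre: "pretangent_family X a r F" using F by (simp add: tangent_family_def)
  obtain k where k: "strict_mono k" and sub: "(\<lambda>x. x \<circ> k) ` F \<subseteq> convergent_family X a (r \<circ> k)"
    using pretangent_family_subseq_in_convergent_family[OF r pre] .
  let ?G = "convergent_family X a (r \<circ> k)"
  let ?\<psi> = "class_limit a (r \<circ> k) \<circ> em_map r k ?G"
  note rk = normalizing_subseq[OF r k]
  have rpos: "\<And>n. 0 < r n" and rkpos: "\<And>n. 0 < (r \<circ> k) n"
    using r by (auto simp: normalizing_def)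
  have fills: "fills_cone X a (r \<circ> k) C ?G" by (rule fills_cone_convergent_family[OF X(1) rk])
  then have stG: "self_stable (r \<circ> k) ?G" by (simp add: fills_cone_def)
  have "maximal_self_stable X (r \<circ> k) ?G"
    using tangent_family_convergent_family[OF X rk]
    by (simp add: tangent_family_def pretangent_family_def)
  then have "isometry_between (pt_space r F) (pt_dist r) (pt_space (r \<circ> k) ?G) (pt_dist (r \<circ> k))
      (em_map r k ?G)"
    using F k sub by (simp add: tangent_family_def)
  then have iso: "isometry_between (pt_space r F) (pt_dist r) C dist ?\<psi>"
    using isometry_class_limit[OF X rk fills] by (rule isometry_between_comp)
  have st: "self_stable r F" and aF: "(\<lambda>n. a) \<in> F"
    using pre by (auto simp: pretangent_family_def maximal_self_stable_def)
  have "em_map r k ?G (pt_proj r F (\<lambda>n. a)) = pt_proj (r \<circ> k) ?G (\<lambda>n. a)"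
    using em_map_pt_proj[OF rpos st k stG sub aF] by (simp add: o_def)
  moreover have "(\<lambda>n. a) \<in> ?G" using sub aF by (force simp: o_def)
  then have "class_limit a (r \<circ> k) (pt_proj (r \<circ> k) ?G (\<lambda>n. a)) = 0"
    by (rule class_limit_pt_proj[OF rkpos stG]) (simp add: blow_up_base)
  ultimately have "?\<psi> (pt_proj r F (\<lambda>n. a)) = 0" by simp
  with iso show ?thesis by blast
qed

theorem theorem1p8:
  fixes X :: "complex set" and a :: complex
  assumes "a \<in> X"
    and "\<exists>S. starlike_center S a \<and> strongly_tangent_equivalent X S a"
  shows "(\<forall>r F. normalizing r \<and> pretangent_family X a r F \<longrightarrow> lies_in_tangent_space X a r F) \<and>
    (\<exists>(B :: complex set) (b :: complex). closed B \<and> cone_vertex B b \<and>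
       (\<forall>r F. normalizing r \<and> tangent_family X a r F \<longrightarrow>
          (\<exists>\<psi>. isometry_between (pt_space r F) (pt_dist r) B dist \<psi> \<and>
               \<psi> (pt_proj r F (\<lambda>n. a)) = b)))"
proof -
  obtain S where S: "starlike_center S a" "strongly_tangent_equivalent X S a"
    using assms(2) by blast
  let ?C = "closed_cone_at S a"
  have X: "has_tangent_cone X a ?C"
    by (rule has_tangent_cone_if_strongly_tangent_equivalent_starlike[OF S])
  have "\<forall>r F. normalizing r \<and> pretangent_family X a r F \<longrightarrow> lies_in_tangent_space X a r F"
    using lies_in_tangent_space_if_has_tangent_cone[OF X assms(1)] by blast
  moreover have "\<forall>r F. normalizing r \<and> tangent_family X a r F \<longrightarrow>
      (\<exists>\<psi>. isometry_between (pt_space r F) (pt_dist r) ?C dist \<psi> \<and> \<psi> (pt_proj r F (\<lambda>n. a)) = 0)"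
    using tangent_space_isometric_to_cone[OF X assms(1)] by blast
  ultimately show ?thesis
    using closed_closed_cone_at[of S a] cone_vertex_closed_cone_at[of S a]
    by (intro conjI exI[of _ ?C] exI[of _ 0])
qed

end
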